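(* Let $\psi$ be a waiting-time density on $\mathbb{N}=\{1,2,\dots\}$, write $\psi_t=\psi(t)$, let $N(t)$ be the generator process with waiting-time density $\psi$, and let $\Phi^{(0)}(t)=\mathbb{P}(N(t)=0)$. Then for all $t\in\mathbb{N}_0$ the state polynomial $\mathcal{P}(v,t)=\mathbb{E}[v^{N(t)}]=\sum_{n=0}^tv^n\,\mathbb{P}(N(t)=n)$ is given by $$\mathcal{P}(v,t)=\sum_{r=0}^t\Phi^{(0)}(t-r)\,\mathcal{B}_r(\psi_1,\dots,\psi_r;v),$$ and the expected number of arrivals is $$\mathbb{E}[N(t)]=\sum_{r=1}^t\mathcal{B}_r(\psi_1,\dots,\psi_r;1)\quad(t\ge1),\qquad \mathbb{E}[N(0)]=0.$$
   Context: A waiting-time density is a function $\psi:\mathbb{N}\to[0,1]$ with $\sum_{t\ge1}\psi(t)=1$. The generator process with waiting-time density $\psi$ is the discrete-time renewal counting process $N(t)=\max\{n\ge0:\Delta t_1+\dots+\Delta t_n\le t\}$, $t\in\mathbb{N}_0$, with $\Delta t_1,\Delta t_2,\dots$ i.i.d., $\mathbb{P}(\Delta t_j=t)=\psi(t)$. The incomplete ordinary Bell polynomials are, for $1\le n\le r$, $$\mathcal{B}_{r,n}(\psi_1,\dots,\psi_{r-n+1})=\sum\frac{n!}{n_1!\cdots n_{r-n+1}!}\,\psi_1^{n_1}\cdots\psi_{r-n+1}^{n_{r-n+1}},$$ the sum being over non-negative integers $n_1,\dots,n_{r-n+1}$ with $\sum_kn_k=n$ and $\sum_kk\,n_k=r$.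 The complete ordinary Bell polynomials are $\mathcal{B}_r(\psi_1,\dots,\psi_r;v)=\sum_{n=1}^rv^n\,\mathcal{B}_{r,n}(\psi_1,\dots,\psi_{r-n+1})$ for $r\ge1$, and $\mathcal{B}_0=1$. *)

theory Defs
  imports "HOL-Probability.Probability"
begin

text \<open>A waiting-time density lives on the positive integers; the value at 0 is irrelevant.\<close>

definition waiting_time_density :: "(nat \<Rightarrow> real) \<Rightarrow> bool" where
  "waiting_time_density \<psi> \<longleftrightarrow>
     (\<forall>t\<ge>1. 0 \<le> \<psi> t \<and> \<psi> t \<le> 1) \<and> (\<psi> has_sum 1) {1..}"

text \<open>The waiting times are indexed from 1. That they are positive is not imposed pointwise:
  the distribution only forces it almost surely.\<close>

locale iid_waiting_times = prob_space M
  for M :: "'a measure" +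
  fixes \<psi> :: "nat \<Rightarrow> real" and \<Delta> :: "nat \<Rightarrow> 'a \<Rightarrow> nat"
  assumes density: "waiting_time_density \<psi>"
    and indep: "indep_vars (\<lambda>_. count_space UNIV) \<Delta> {1..}"
    and distribution:
      "\<And>j t. 1 \<le> j \<Longrightarrow> 1 \<le> t \<Longrightarrow> prob {\<omega> \<in> space M. \<Delta> j \<omega> = t} = \<psi> t"

text \<open>The set below always contains 0, and it is finite whenever all waiting times are positive,
  hence almost surely; only on the exceptional null set can \<open>Max\<close> be unspecified.\<close>

definition generator_process :: "(nat \<Rightarrow> 'a \<Rightarrow> nat) \<Rightarrow> nat \<Rightarrow> 'a \<Rightarrow> nat" where
  "generator_process \<Delta> t \<omega> = Max {n. (\<Sum>j=1..n. \<Delta> j \<omega>) \<le> t}"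

definition state_prob :: "'a measure \<Rightarrow> (nat \<Rightarrow> 'a \<Rightarrow> nat) \<Rightarrow> nat \<Rightarrow> nat \<Rightarrow> real" where
  "state_prob M N n t = measure M {\<omega> \<in> space M. N t \<omega> = n}"

text \<open>The type of the variable is general enough to cover both real and complex arguments.\<close>

definition state_polynomial ::
  "'a measure \<Rightarrow> (nat \<Rightarrow> 'a \<Rightarrow> nat) \<Rightarrow> 'b \<Rightarrow> nat \<Rightarrow>
     'b::{real_normed_field, banach, second_countable_topology}" where
  "state_polynomial M N v t = (LINT \<omega>|M. v ^ N t \<omega>)"

text \<open>The multiplicities \<open>(n\<^sub>1, \<dots>, n\<^bsub>r-n+1\<^esub>)\<close> are extensional functions on \<open>{1..r-n+1}\<close>.
  The definitions are meant for \<open>1 \<le> n \<le> r\<close>.\<close>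

definition bell_indices :: "nat \<Rightarrow> nat \<Rightarrow> (nat \<Rightarrow> nat) set" where
  "bell_indices r n =
     {m \<in> {1..r - n + 1} \<rightarrow>\<^sub>E UNIV.
        (\<Sum>k=1..r - n + 1. m k) = n \<and> (\<Sum>k=1..r - n + 1. k * m k) = r}"

lemma finite_bell_indices: "finite (bell_indices r n)"
proof (rule finite_subset)
  show "bell_indices r n \<subseteq> {1..r - n + 1} \<rightarrow>\<^sub>E {..n}"
  proof
    fix m assume m: "m \<in> bell_indices r n"
    have "m k \<le> n" if "k \<in> {1..r - n + 1}" for k
    proof -
      have "m k \<le> (\<Sum>k=1..r - n + 1. m k)"
        using that by (intro member_le_sum) auto
      then show ?thesis
        using m by (simp add: bell_indices_def)
    qed
    with m show "m \<in> {1..r - n + 1} \<rightarrow>\<^sub>E {..n}"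
      by (auto simp: bell_indices_def PiE_def)
  qed
  show "finite ({1..r - n + 1} \<rightarrow>\<^sub>E {..n})"
    by (intro finite_PiE) auto
qed

definition incomplete_bell :: "nat \<Rightarrow> nat \<Rightarrow> (nat \<Rightarrow> 'b::field_char_0) \<Rightarrow> 'b" where
  "incomplete_bell r n x =
     (\<Sum>m\<in>bell_indices r n.
        fact n / (\<Prod>k=1..r - n + 1. fact (m k)) * (\<Prod>k=1..r - n + 1. x k ^ m k))"

definition complete_bell :: "nat \<Rightarrow> (nat \<Rightarrow> 'b::field_char_0) \<Rightarrow> 'b \<Rightarrow> 'b" where
  "complete_bell r x v =
     (if r = 0 then 1 else (\<Sum>n=1..r. v ^ n * incomplete_bell r n x))"

end

theory Submission
  imports Defs
begin

text \<open>
  Let \<open>T\<^sub>n = \<Delta>\<^sub>1 + \<dots> + \<Delta>\<^sub>n\<close> be the epoch of the \<open>n\<close>-th arrival. Everything rests on the identity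
  \<open>P(T\<^sub>n = r) = B\<^bsub>r,n\<^esub>(\<psi>)\<close>, the lemma \<open>prob_epoch_eq_incomplete_bell\<close>: both sides are the
  coefficient of \<open>z\<^sup>r\<close> in the \<open>n\<close>-th power of \<open>\<psi>\<^sub>1 z + \<psi>\<^sub>2 z\<^sup>2 + \<dots>\<close>, on the left because the waiting
  times are independent, on the right by the multinomial theorem. The proof compares recursions in
  \<open>n\<close> instead of power series. On the left, conditioning on the last waiting time gives the
  convolution \<open>P(T\<^bsub>n+1\<^esub> = r) = \<Sum>\<^sub>k \<psi>\<^sub>k P(T\<^sub>n = r - k)\<close>; on the right, removing one part from a
  family of multiplicities gives the same formula (\<open>multinomial_sum_Suc\<close>).

  The identity yields both claims since almost surely all waiting times are positive, so that
  \<open>n \<le> N(t)\<close> means \<open>T\<^sub>n \<le> t\<close>. Firstly, \<open>N(t) = n\<close> says that the \<open>n\<close>-th arrival happens at some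
  time \<open>r \<le> t\<close> and that the next waiting time, which is independent of the past, exceeds
  \<open>t - r\<close>. Hence \<open>P(N(t) = n) = \<Sum>\<^sub>r P(T\<^sub>n = r) P(N(t - r) = 0)\<close> (\<open>state_prob_eq_convolution\<close>);
  multiplying by \<open>v\<^sup>n\<close> and summing over \<open>n\<close> first turns the factors \<open>P(T\<^sub>n = r)\<close> into the complete
  Bell polynomial of index \<open>r\<close>. Secondly, \<open>E[N(t)]\<close> is the sum of \<open>P(N(t) \<ge> n) = P(T\<^sub>n \<le> t)\<close> over
  \<open>n \<ge> 1\<close>, which is the sum of \<open>P(T\<^sub>n = r)\<close> over \<open>1 \<le> n \<le> r \<le> t\<close>.
\<close>

section \<open>Multinomial sums over an arbitrary set of part sizes\<close>

text \<open>The range of the multiplicities in an incomplete Bell polynomial depends on \<open>r\<close> and \<open>n\<close>, both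
  of which change along the recursion. Allowing a fixed set \<open>A\<close> of part sizes removes this
  obstacle.\<close>

definition multiplicities :: "nat set \<Rightarrow> nat \<Rightarrow> nat \<Rightarrow> (nat \<Rightarrow> nat) set" where
  "multiplicities A n r =
     {m \<in> A \<rightarrow>\<^sub>E UNIV. (\<Sum>k\<in>A. m k) = n \<and> (\<Sum>k\<in>A. k * m k) = r}"

text \<open>By the multinomial theorem, this is the coefficient of \<open>z\<^sup>r\<close> in
  \<open>(\<Sum>k\<in>A. x k * z ^ k) ^ n\<close>.\<close>

definition multinomial_sum :: "nat set \<Rightarrow> nat \<Rightarrow> nat \<Rightarrow> (nat \<Rightarrow> 'b::field_char_0) \<Rightarrow> 'b" where
  "multinomial_sum A n r x =
     (\<Sum>m\<in>multiplicities A n r. fact n / (\<Prod>k\<in>A. fact (m k)) * (\<Prod>k\<in>A. x k ^ m k))"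

lemma incomplete_bell_eq_multinomial_sum:
  "incomplete_bell r n x = multinomial_sum {1..r - n + 1} n r x"
  by (simp add: incomplete_bell_def multinomial_sum_def bell_indices_def multiplicities_def)

lemma finite_multiplicities:
  assumes "finite A"
  shows "finite (multiplicities A n r)"
proof (rule finite_subset)
  show "multiplicities A n r \<subseteq> A \<rightarrow>\<^sub>E {..n}"
    using assms by (auto simp: multiplicities_def PiE_def intro: member_le_sum)
  show "finite (A \<rightarrow>\<^sub>E {..n})"
    using assms by (intro finite_PiE) auto
qed

lemma multinomial_sum_0:
  assumes "finite A"
  shows "multinomial_sum A 0 r x = (if r = 0 then 1 else 0)"
proof -
  have "multiplicities A 0 r = (if r = 0 then {\<lambda>k\<in>A. 0} else {})"
    using assms by (auto simp: multiplicities_def PiE_def extensional_def)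
  then show ?thesis
    by (simp add: multinomial_sum_def)
qed

text \<open>Lowering the multiplicity \<open>m k\<close> by one is a bijection from the families with \<open>m k > 0\<close> to the
  families with one part fewer and total \<open>r - k\<close>; the weight \<open>m k\<close> turns the factor
  \<open>1 / fact (m k)\<close> into \<open>1 / fact (m k - 1)\<close>.\<close>

lemma remove_part:
  fixes x :: "nat \<Rightarrow> 'b::field_char_0"
  assumes A: "finite A" "k \<in> A"
  shows "(\<Sum>m\<in>multiplicities A (Suc n) r.
            of_nat (m k) * (fact n / (\<Prod>i\<in>A. fact (m i)) * (\<Prod>i\<in>A. x i ^ m i)))
         = (if k \<le> r then x k * multinomial_sum A n (r - k) x else 0)"
proof -
  let ?f = "\<lambda>m. of_nat (m k) * (fact n / (\<Prod>i\<in>A. fact (m i)) * (\<Prod>i\<in>A. x i ^ m i))"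
  let ?P = "{m \<in> multiplicities A (Suc n) r. 0 < m k}"
  have "(\<Sum>m\<in>multiplicities A (Suc n) r. ?f m) = (\<Sum>m\<in>?P. ?f m)"
    using A by (intro sum.mono_neutral_right) (auto simp: finite_multiplicities)
  also have "\<dots> = (if k \<le> r then x k * multinomial_sum A n (r - k) x else 0)"
  proof (cases "k \<le> r")
    case True
    have "(\<Sum>m\<in>?P. ?f m) = (\<Sum>m\<in>multiplicities A n (r - k).
            x k * (fact n / (\<Prod>i\<in>A. fact (m i)) * (\<Prod>i\<in>A. x i ^ m i)))"
    proof (rule sum.reindex_bij_witness[where i = "\<lambda>m. m(k := Suc (m k))"
            and j = "\<lambda>m. m(k := m k - 1)"])
      fix m assume m: "m \<in> ?P"
      then obtain c where c: "m k = Suc c"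
        by (cases "m k") auto
      have 1: "(\<Sum>i\<in>A - {k}. (m(k := c)) i) = (\<Sum>i\<in>A - {k}. m i)"
        "(\<Sum>i\<in>A - {k}. i * (m(k := c)) i) = (\<Sum>i\<in>A - {k}. i * m i)"
        by (auto intro!: sum.cong)
      have 2: "(\<Prod>i\<in>A - {k}. fact ((m(k := c)) i)) = (\<Prod>i\<in>A - {k}. fact (m i) :: 'b)"
        "(\<Prod>i\<in>A - {k}. x i ^ (m(k := c)) i) = (\<Prod>i\<in>A - {k}. x i ^ m i)"
        by (auto intro!: prod.cong)
      show "(m(k := m k - 1))(k := Suc ((m(k := m k - 1)) k)) = m"
        using c by auto
      show "m(k := m k - 1) \<in> multiplicities A n (r - k)"
        using m A c 1
        by (auto simp: multiplicities_def sum.remove[of A k] PiE_def extensional_def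
              simp del: fun_upd_apply) (auto simp: algebra_simps)
      show "x k * (fact n / (\<Prod>i\<in>A. fact ((m(k := m k - 1)) i)) *
              (\<Prod>i\<in>A. x i ^ (m(k := m k - 1)) i)) = ?f m"
        using A c 2 by (simp add: prod.remove[of A k] del: of_nat_Suc)
    next
      fix m assume m: "m \<in> multiplicities A n (r - k)"
      have 1: "(\<Sum>i\<in>A - {k}. (m(k := Suc (m k))) i) = (\<Sum>i\<in>A - {k}. m i)"
        "(\<Sum>i\<in>A - {k}. i * (m(k := Suc (m k))) i) = (\<Sum>i\<in>A - {k}. i * m i)"
        by (auto intro!: sum.cong)
      show "(m(k := Suc (m k)))(k := (m(k := Suc (m k))) k - 1) = m"
        by simp
      show "m(k := Suc (m k)) \<in> ?P"
        using m A True 1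
        by (auto simp: multiplicities_def sum.remove[of A k] PiE_def extensional_def
              simp del: fun_upd_apply) (auto simp: algebra_simps)
    qed
    then show ?thesis
      using True by (simp add: multinomial_sum_def sum_distrib_left)
  next
    case False
    have "?P = {}"
    proof safe
      fix m assume m: "m \<in> multiplicities A (Suc n) r" and "0 < m k"
      have "k * 1 \<le> k * m k"
        using \<open>0 < m k\<close> by (intro mult_left_mono) auto
      also have "\<dots> \<le> (\<Sum>i\<in>A. i * m i)"
        using A by (intro member_le_sum) auto
      finally show "m \<in> {}"
        using m False by (simp add: multiplicities_def)
    qed
    then show ?thesis
      using False by (simp only: sum.empty if_False)
  qed
  finally show ?thesis .
qed

text \<open>The factor \<open>n + 1\<close> of \<open>fact (n + 1)\<close> is the total multiplicity \<open>\<Sum>k\<in>A. m k\<close>; distributing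
  it over \<open>k\<close> splits the sum according to the size of a removed part.\<close>

lemma multinomial_sum_Suc:
  fixes x :: "nat \<Rightarrow> 'b::field_char_0"
  assumes "finite A"
  shows "multinomial_sum A (Suc n) r x
           = (\<Sum>k\<in>A. if k \<le> r then x k * multinomial_sum A n (r - k) x else 0)"
proof -
  let ?w = "\<lambda>m. fact n / (\<Prod>i\<in>A. fact (m i)) * (\<Prod>i\<in>A. x i ^ m i)"
  have "multinomial_sum A (Suc n) r x
          = (\<Sum>m\<in>multiplicities A (Suc n) r. \<Sum>k\<in>A. of_nat (m k) * ?w m)"
    unfolding multinomial_sum_def
  proof (rule sum.cong)
    fix m assume "m \<in> multiplicities A (Suc n) r"
    then have "(\<Sum>k\<in>A. of_nat (m k) :: 'b) = of_nat (Suc n)"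
      by (simp add: multiplicities_def flip: of_nat_sum)
    then have "(\<Sum>k\<in>A. of_nat (m k) * ?w m) = of_nat (Suc n) * ?w m"
      by (simp only: sum_distrib_right[symmetric])
    then show "fact (Suc n) / (\<Prod>i\<in>A. fact (m i)) * (\<Prod>i\<in>A. x i ^ m i)
                 = (\<Sum>k\<in>A. of_nat (m k) * ?w m)"
      by simp
  qed simp
  also have "\<dots> = (\<Sum>k\<in>A. \<Sum>m\<in>multiplicities A (Suc n) r. of_nat (m k) * ?w m)"
    by (rule sum.swap)
  also have "\<dots> = (\<Sum>k\<in>A. if k \<le> r then x k * multinomial_sum A n (r - k) x else 0)"
    using assms by (intro sum.cong remove_part) auto
  finally show ?thesis .
qed

lemma incomplete_bell_of_real:
  "incomplete_bell r n (\<lambda>k. of_real (x k) :: 'b::{real_normed_field})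
     = of_real (incomplete_bell r n x)"
  by (simp add: incomplete_bell_def)

section \<open>Renewal epochs\<close>

text \<open>Positive waiting times make the partial sums increase at least as fast as \<open>n\<close>, so the set
  whose maximum defines the process is a finite initial segment of the natural numbers.\<close>

lemma le_generator_process_iff:
  assumes pos: "\<And>j. 1 \<le> j \<Longrightarrow> 1 \<le> \<Delta> j \<omega>"
  shows "n \<le> generator_process \<Delta> t \<omega> \<longleftrightarrow> (\<Sum>j=1..n. \<Delta> j \<omega>) \<le> t"
proof -
  define S where "S n = (\<Sum>j=1..n. \<Delta> j \<omega>)" for n
  have ge: "n \<le> S n" for n
    using sum_mono[of "{1..n}" "\<lambda>_. 1" "\<lambda>j. \<Delta> j \<omega>"] pos by (simp add: S_def)
  have mono: "S m \<le> S n" if "m \<le> n" for m n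
    unfolding S_def using that by (intro sum_mono2) auto
  have fin: "finite {n. S n \<le> t}"
    by (rule finite_subset[of _ "{..t}"]) (auto intro: order_trans[OF ge])
  have 0: "0 \<in> {n. S n \<le> t}"
    by (simp add: S_def)
  have N: "generator_process \<Delta> t \<omega> = Max {n. S n \<le> t}"
    by (simp add: generator_process_def S_def)
  have "Max {n. S n \<le> t} \<in> {n. S n \<le> t}"
    using fin 0 by (intro Max_in) auto
  then have "S (generator_process \<Delta> t \<omega>) \<le> t"
    by (simp add: N)
  moreover have "n \<le> generator_process \<Delta> t \<omega>" if "S n \<le> t"
    unfolding N using fin that by (intro Max_ge) auto
  ultimately have "n \<le> generator_process \<Delta> t \<omega> \<longleftrightarrow> S n \<le> t"
    using mono order_trans by blast
  then show ?thesis
    by (simp add: S_def)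
qed

lemma (in prob_space) prob_in_finite_set:
  assumes [measurable]: "X \<in> measurable M (count_space UNIV)" and "finite F"
  shows "prob {\<omega> \<in> space M. X \<omega> \<in> F} = (\<Sum>k\<in>F. prob {\<omega> \<in> space M. X \<omega> = k})"
proof -
  have "{\<omega> \<in> space M. X \<omega> \<in> F} = (\<Union>k\<in>F. {\<omega> \<in> space M. X \<omega> = k})"
    by auto
  then show ?thesis
    using assms(2)
    by (simp only:, subst finite_measure_finite_Union) (auto simp: disjoint_family_on_def)
qed

context iid_waiting_times
begin

lemma measurable_waiting_time [measurable]:
  assumes "1 \<le> j"
  shows "\<Delta> j \<in> measurable M (count_space UNIV)"
  using indep assms by (auto simp: indep_vars_def2)

definition epoch :: "nat \<Rightarrow> 'a \<Rightarrow> nat" where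
  "epoch n \<omega> = (\<Sum>j=1..n. \<Delta> j \<omega>)"

lemma measurable_epoch [measurable]: "epoch n \<in> measurable M (count_space UNIV)"
  unfolding epoch_def[abs_def] by measurable

lemma measurable_generator_process [measurable]:
  "generator_process \<Delta> t \<in> measurable M (count_space UNIV)"
  unfolding generator_process_def[abs_def] epoch_def[symmetric] by measurable

text \<open>Finitely many of the events \<open>\<Delta>\<^sub>j = k\<close> with \<open>k \<ge> 1\<close> leave room for \<open>\<Delta>\<^sub>j = 0\<close> next to them, and
  their probabilities come arbitrarily close to 1.\<close>

lemma prob_waiting_time_0:
  assumes "1 \<le> j"
  shows "prob {\<omega> \<in> space M. \<Delta> j \<omega> = 0} = 0"
proof -
  let ?p = "\<lambda>k. prob {\<omega> \<in> space M. \<Delta> j \<omega> = k}"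
  have "sum \<psi> F \<le> 1 - ?p 0" if F: "finite F" "F \<subseteq> {1..}" for F
  proof -
    have "sum \<psi> F = sum ?p F"
      using F assms by (intro sum.cong) (auto simp: distribution)
    then have "sum \<psi> F + ?p 0 = sum ?p (insert 0 F)"
      using F by (subst sum.insert) auto
    also have "\<dots> = prob {\<omega> \<in> space M. \<Delta> j \<omega> \<in> insert 0 F}"
      using F assms by (intro prob_in_finite_set[symmetric]) auto
    also have "\<dots> \<le> 1"
      by simp
    finally show ?thesis by simp
  qed
  moreover have "(\<psi> has_sum 1) {1..}"
    using density by (simp add: waiting_time_density_def)
  ultimately have "1 \<le> 1 - ?p 0"
    by (rule has_sum_le_finite_sums[rotated])
  then show ?thesis
    by (simp add: measure_le_0_iff)
qed

lemma AE_waiting_times_positive: "AE \<omega> in M. \<forall>j\<ge>1. 1 \<le> \<Delta> j \<omega>"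
proof -
  have "AE \<omega> in M. 1 \<le> j \<longrightarrow> 1 \<le> \<Delta> j \<omega>" for j
  proof (cases "1 \<le> j")
    case True
    then have [measurable]: "\<Delta> j \<in> measurable M (count_space UNIV)"
      by simp
    have "AE \<omega> in M. \<not> \<Delta> j \<omega> = 0"
      using prob_waiting_time_0[OF True]
      by (subst AE_iff_measurable[OF _ refl]) (auto simp: emeasure_eq_measure)
    then show ?thesis
      by eventually_elim auto
  qed simp
  then show ?thesis
    by (simp add: AE_all_countable)
qed

lemma prob_waiting_time_gt:
  assumes "1 \<le> j"
  shows "prob {\<omega> \<in> space M. s < \<Delta> j \<omega>} = 1 - (\<Sum>k=1..s. \<psi> k)"
proof -
  have [measurable]: "\<Delta> j \<in> measurable M (count_space UNIV)"
    using assms by simp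
  have "prob {\<omega> \<in> space M. \<not> \<Delta> j \<omega> \<in> {..s}} = 1 - prob {\<omega> \<in> space M. \<Delta> j \<omega> \<in> {..s}}"
    by (rule prob_neg) simp
  also have "prob {\<omega> \<in> space M. \<Delta> j \<omega> \<in> {..s}} = (\<Sum>k\<in>{..s}. prob {\<omega> \<in> space M. \<Delta> j \<omega> = k})"
    by (rule prob_in_finite_set) simp_all
  also have "\<dots> = (\<Sum>k=1..s. prob {\<omega> \<in> space M. \<Delta> j \<omega> = k})"
    using assms by (intro sum.mono_neutral_right) (auto simp: prob_waiting_time_0 not_le)
  also have "\<dots> = (\<Sum>k=1..s. \<psi> k)"
    using assms by (intro sum.cong) (auto simp: distribution)
  finally show ?thesis
    by (simp add: not_le)
qed

text \<open>The epoch \<open>T\<^sub>n\<close> is a function of \<open>\<Delta>\<^sub>1, \<dots>, \<Delta>\<^sub>n\<close>, hence independent of \<open>\<Delta>\<^bsub>n+1\<^esub>\<close>.\<close>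

lemma prob_epoch_and_next_waiting_time:
  "prob {\<omega> \<in> space M. epoch n \<omega> = s \<and> \<Delta> (Suc n) \<omega> \<in> B}
     = prob {\<omega> \<in> space M. epoch n \<omega> = s} * prob {\<omega> \<in> space M. \<Delta> (Suc n) \<omega> \<in> B}"
proof -
  let ?C = "\<lambda>_. count_space UNIV :: nat measure"
  let ?past = "\<lambda>f. \<Sum>j=1..n. f j" and ?next = "\<lambda>f. f (Suc n)"
  have "indep_var (PiM {1..n} ?C) (\<lambda>\<omega>. restrict (\<lambda>j. \<Delta> j \<omega>) {1..n})
          (PiM {Suc n} ?C) (\<lambda>\<omega>. restrict (\<lambda>j. \<Delta> j \<omega>) {Suc n})"
    by (rule indep_var_restrict[OF indep]) auto
  then have "indep_var (count_space UNIV) (?past \<circ> (\<lambda>\<omega>. restrict (\<lambda>j. \<Delta> j \<omega>) {1..n}))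
          (count_space UNIV) (?next \<circ> (\<lambda>\<omega>. restrict (\<lambda>j. \<Delta> j \<omega>) {Suc n}))"
    by (rule indep_var_compose) (measurable; auto)+
  then have "indep_var (count_space UNIV) (epoch n) (count_space UNIV) (\<Delta> (Suc n))"
    by (simp add: comp_def epoch_def[abs_def])
  from indep_varD[OF this, of "{s}" B] show ?thesis
    by (simp add: vimage_def Int_def conj_commute)
qed

lemma prob_epoch_0: "prob {\<omega> \<in> space M. epoch 0 \<omega> = r} = (if r = 0 then 1 else 0)"
  by (simp add: epoch_def prob_space)

lemma prob_epoch_Suc:
  "prob {\<omega> \<in> space M. epoch (Suc n) \<omega> = r}
     = (\<Sum>k=1..r. \<psi> k * prob {\<omega> \<in> space M. epoch n \<omega> = r - k})"
proof -
  have [measurable]: "\<Delta> (Suc n) \<in> measurable M (count_space UNIV)"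
    by simp
  let ?E = "\<lambda>k. {\<omega> \<in> space M. epoch n \<omega> = r - k \<and> \<Delta> (Suc n) \<omega> \<in> {k}}"
  have "{\<omega> \<in> space M. epoch (Suc n) \<omega> = r} = (\<Union>k\<in>{..r}. ?E k)"
    by (auto simp: epoch_def)
  moreover have "prob (\<Union>k\<in>{..r}. ?E k) = (\<Sum>k\<in>{..r}. prob (?E k))"
    by (rule finite_measure_finite_Union) (auto simp: disjoint_family_on_def image_subset_iff)
  ultimately have "prob {\<omega> \<in> space M. epoch (Suc n) \<omega> = r} = (\<Sum>k\<in>{..r}. prob (?E k))"
    by simp
  also have "\<dots> = (\<Sum>k\<in>{..r}. prob {\<omega> \<in> space M. epoch n \<omega> = r - k} *
                      prob {\<omega> \<in> space M. \<Delta> (Suc n) \<omega> = k})"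
    by (simp only: prob_epoch_and_next_waiting_time) (simp only: singleton_iff)
  also have "\<dots> = (\<Sum>k=1..r. prob {\<omega> \<in> space M. epoch n \<omega> = r - k} *
                      prob {\<omega> \<in> space M. \<Delta> (Suc n) \<omega> = k})"
    by (intro sum.mono_neutral_right) (auto simp: prob_waiting_time_0 not_le)
  also have "\<dots> = (\<Sum>k=1..r. \<psi> k * prob {\<omega> \<in> space M. epoch n \<omega> = r - k})"
    by (intro sum.cong) (auto simp: distribution)
  finally show ?thesis .
qed

lemma prob_epoch_less:
  assumes "r < n"
  shows "prob {\<omega> \<in> space M. epoch n \<omega> = r} = 0"
  using assms
proof (induction n arbitrary: r)
  case (Suc n)
  have "prob {\<omega> \<in> space M. epoch n \<omega> = r - k} = 0" if "k \<in> {1..r}" for k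
    using that Suc.prems by (intro Suc.IH) auto
  then show ?case
    by (simp add: prob_epoch_Suc)
qed simp

text \<open>Part sizes beyond \<open>r - n + 1\<close> do not occur because the other \<open>n - 1\<close> parts already need
  \<open>n - 1\<close> units. This is why any upper bound \<open>K\<close> from there on gives the same value; the freedom in
  \<open>K\<close> lets the induction on \<open>n\<close> keep it fixed.\<close>

lemma prob_epoch_eq_multinomial_sum:
  assumes "r - n + 1 \<le> K"
  shows "prob {\<omega> \<in> space M. epoch n \<omega> = r} = multinomial_sum {1..K} n r \<psi>"
  using assms
proof (induction n arbitrary: r)
  case 0
  then show ?case
    by (simp add: prob_epoch_0 multinomial_sum_0)
next
  case (Suc n)
  let ?p = "\<lambda>s. prob {\<omega> \<in> space M. epoch n \<omega> = s}"
  have "prob {\<omega> \<in> space M. epoch (Suc n) \<omega> = r} = (\<Sum>k=1..r. \<psi> k * ?p (r - k))"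
    by (rule prob_epoch_Suc)
  \<comment> \<open>For \<open>k > K\<close> the remaining time \<open>r - k\<close> is too short for \<open>n\<close> arrivals.\<close>
  also have "\<dots> = (\<Sum>k\<in>{1..r} \<inter> {1..K}. \<psi> k * ?p (r - k))"
    using Suc.prems by (intro sum.mono_neutral_right) (auto intro!: prob_epoch_less)
  also have "\<dots> = (\<Sum>k\<in>{1..r} \<inter> {1..K}. \<psi> k * multinomial_sum {1..K} n (r - k) \<psi>)"
    using Suc.prems by (intro sum.cong refl) (subst Suc.IH, auto)
  also have "\<dots> = (\<Sum>k=1..K. if k \<le> r then \<psi> k * multinomial_sum {1..K} n (r - k) \<psi> else 0)"
    by (intro sum.mono_neutral_cong_left) auto
  also have "\<dots> = multinomial_sum {1..K} (Suc n) r \<psi>"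
    by (simp only: multinomial_sum_Suc finite_atLeastAtMost)
  finally show ?case .
qed

lemma prob_epoch_eq_incomplete_bell:
  "prob {\<omega> \<in> space M. epoch n \<omega> = r} = incomplete_bell r n \<psi>"
  by (simp only: prob_epoch_eq_multinomial_sum incomplete_bell_eq_multinomial_sum order_refl)

text \<open>Extending the sum up to \<open>t\<close> adds only zeros, as \<open>n\<close> arrivals take at least \<open>n\<close> time units. It
  makes the range of \<open>n\<close> independent of \<open>r\<close>, so that sums over \<open>n\<close> and \<open>r\<close> can be exchanged. The
  term \<open>n = 0\<close> accounts for the convention that the complete Bell polynomial of index 0 is 1.\<close>

lemma complete_bell_eq_generating_function:
  fixes v :: "'b::real_normed_field"
  assumes "r \<le> t"
  shows "complete_bell r (\<lambda>k. of_real (\<psi> k)) v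
           = (\<Sum>n=0..t. v ^ n * of_real (prob {\<omega> \<in> space M. epoch n \<omega> = r}))"
proof -
  let ?g = "\<lambda>n. v ^ n * of_real (prob {\<omega> \<in> space M. epoch n \<omega> = r})"
  have "(\<Sum>n=0..t. ?g n) = (\<Sum>n=0..r. ?g n)"
    using assms by (intro sum.mono_neutral_right) (auto simp: prob_epoch_less)
  also have "\<dots> = complete_bell r (\<lambda>k. of_real (\<psi> k)) v"
  proof (cases "r = 0")
    case True
    then show ?thesis
      by (simp add: complete_bell_def prob_epoch_0)
  next
    case False
    then have "(\<Sum>n=0..r. ?g n) = (\<Sum>n=1..r. ?g n)"
      by (simp add: sum.atLeast_Suc_atMost[of 0] prob_epoch_0)
    then show ?thesis
      using False
      by (simp add: complete_bell_def incomplete_bell_of_real prob_epoch_eq_incomplete_bell)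
  qed
  finally show ?thesis by simp
qed

section \<open>The counting process\<close>

lemma AE_le_generator_process_iff:
  "AE \<omega> in M. \<forall>n. n \<le> generator_process \<Delta> t \<omega> \<longleftrightarrow> epoch n \<omega> \<le> t"
  using AE_waiting_times_positive
  by eventually_elim (simp add: le_generator_process_iff epoch_def)

lemma AE_epoch_ge: "AE \<omega> in M. \<forall>n. n \<le> epoch n \<omega>"
  using AE_waiting_times_positive
proof eventually_elim
  case (elim \<omega>)
  show ?case
  proof
    fix n show "n \<le> epoch n \<omega>"
      using sum_mono[of "{1..n}" "\<lambda>_. 1" "\<lambda>j. \<Delta> j \<omega>"] elim by (simp add: epoch_def)
  qed
qed

lemma AE_generator_process_le: "AE \<omega> in M. generator_process \<Delta> t \<omega> \<le> t"
  using AE_le_generator_process_iff[of t] AE_epoch_ge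
proof eventually_elim
  case (elim \<omega>)
  then have "epoch (generator_process \<Delta> t \<omega>) \<omega> \<le> t"
    by blast
  with elim(2)[rule_format, of "generator_process \<Delta> t \<omega>"] show ?case
    by linarith
qed

lemma state_prob_0:
  "state_prob M (generator_process \<Delta>) 0 s = 1 - (\<Sum>k=1..s. \<psi> k)"
proof -
  have [measurable]: "\<Delta> (Suc 0) \<in> measurable M (count_space UNIV)"
    by simp
  have "state_prob M (generator_process \<Delta>) 0 s = prob {\<omega> \<in> space M. s < \<Delta> 1 \<omega>}"
    unfolding state_prob_def
  proof (rule measure_eq_AE)
    show "AE \<omega> in M. \<omega> \<in> {\<omega> \<in> space M. generator_process \<Delta> s \<omega> = 0}
                 \<longleftrightarrow> \<omega> \<in> {\<omega> \<in> space M. s < \<Delta> 1 \<omega>}"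
      using AE_le_generator_process_iff[of s]
    proof eventually_elim
      case (elim \<omega>)
      from elim[rule_format, of 1] show ?case
        by (auto simp: epoch_def)
    qed
  qed auto
  then show ?thesis
    by (simp add: prob_waiting_time_gt)
qed

text \<open>The event \<open>N(t) = n\<close> is decomposed by the epoch \<open>r\<close> of the last arrival. The renewal property
  enters through \<open>\<Delta>\<^bsub>n+1\<^esub>\<close> having the same tail as \<open>\<Delta>\<^sub>1\<close>: no arrival during a further \<open>t - r\<close> time
  units is as likely as no arrival up to time \<open>t - r\<close>.\<close>

lemma state_prob_eq_convolution:
  "state_prob M (generator_process \<Delta>) n t
     = (\<Sum>r=0..t. prob {\<omega> \<in> space M. epoch n \<omega> = r}
                    * state_prob M (generator_process \<Delta>) 0 (t - r))"
proof -
  have [measurable]: "\<Delta> (Suc n) \<in> measurable M (count_space UNIV)"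
    by simp
  let ?E = "\<lambda>r. {\<omega> \<in> space M. epoch n \<omega> = r \<and> \<Delta> (Suc n) \<omega> \<in> {t - r<..}}"
  have "state_prob M (generator_process \<Delta>) n t = prob (\<Union>r\<in>{0..t}. ?E r)"
    unfolding state_prob_def
  proof (rule measure_eq_AE)
    show "AE \<omega> in M. \<omega> \<in> {\<omega> \<in> space M. generator_process \<Delta> t \<omega> = n}
                 \<longleftrightarrow> \<omega> \<in> (\<Union>r\<in>{0..t}. ?E r)"
      using AE_le_generator_process_iff[of t]
    proof eventually_elim
      case (elim \<omega>)
      have "generator_process \<Delta> t \<omega> = n \<longleftrightarrow> epoch n \<omega> \<le> t \<and> t < epoch (Suc n) \<omega>"
        using elim[rule_format, of n] elim[rule_format, of "Suc n"] by linarith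
      then show ?case
        by (auto simp: epoch_def)
    qed
  qed auto
  also have "\<dots> = (\<Sum>r=0..t. prob (?E r))"
    by (rule finite_measure_finite_Union) (auto simp: disjoint_family_on_def image_subset_iff)
  also have "\<dots> = (\<Sum>r=0..t. prob {\<omega> \<in> space M. epoch n \<omega> = r}
                    * state_prob M (generator_process \<Delta>) 0 (t - r))"
    by (simp only: prob_epoch_and_next_waiting_time)
       (simp add: state_prob_0 prob_waiting_time_gt)
  finally show ?thesis .
qed

lemma state_polynomial_eq_sum:
  fixes v :: "'b::{real_normed_field, banach, second_countable_topology}"
  shows "state_polynomial M (generator_process \<Delta>) v t
           = (\<Sum>n=0..t. v ^ n * of_real (state_prob M (generator_process \<Delta>) n t))"
proof -
  let ?N = "generator_process \<Delta> t"
  let ?E = "\<lambda>n. {\<omega> \<in> space M. ?N \<omega> = n}"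
  have "state_polynomial M (generator_process \<Delta>) v t
          = (LINT \<omega>|M. (\<Sum>n=0..t. indicator (?E n) \<omega> *\<^sub>R v ^ n))"
    unfolding state_polynomial_def
  proof (rule integral_cong_AE)
    show "AE \<omega> in M. v ^ ?N \<omega> = (\<Sum>n=0..t. indicator (?E n) \<omega> *\<^sub>R v ^ n)"
      using AE_generator_process_le[of t] AE_space
    proof eventually_elim
      case (elim \<omega>)
      have "(\<Sum>n=0..t. indicator (?E n) \<omega> *\<^sub>R v ^ n)
              = (\<Sum>n=0..t. if ?N \<omega> = n then v ^ n else 0)"
        using elim by (intro sum.cong) (auto simp: indicator_def)
      then show ?case
        using elim by simp
    qed
  qed measurable
  also have "\<dots> = (\<Sum>n=0..t. prob (?E n) *\<^sub>R v ^ n)"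
    by (subst Bochner_Integration.integral_sum) (auto simp: emeasure_eq_measure)
  finally show ?thesis
    by (simp add: state_prob_def scaleR_conv_of_real mult.commute)
qed

text \<open>The tail formula \<open>E[N] = \<Sum>\<^bsub>n\<ge>1\<^esub> P(N \<ge> n)\<close>: almost surely \<open>N(t)\<close> counts the \<open>n \<in> {1..t}\<close> with
  \<open>n \<le> N(t)\<close>, that is, with \<open>T\<^sub>n \<le> t\<close>.\<close>

lemma expectation_generator_process:
  "(LINT \<omega>|M. real (generator_process \<Delta> t \<omega>))
     = (\<Sum>n=1..t. \<Sum>r=0..t. prob {\<omega> \<in> space M. epoch n \<omega> = r})"
proof -
  let ?N = "generator_process \<Delta> t"
  let ?E = "\<lambda>n. {\<omega> \<in> space M. epoch n \<omega> \<le> t}"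
  have "(LINT \<omega>|M. real (?N \<omega>)) = (LINT \<omega>|M. (\<Sum>n=1..t. indicator (?E n) \<omega>))"
  proof (rule integral_cong_AE)
    show "AE \<omega> in M. real (?N \<omega>) = (\<Sum>n=1..t. indicator (?E n) \<omega>)"
      using AE_le_generator_process_iff[of t] AE_generator_process_le[of t] AE_space
    proof eventually_elim
      case (elim \<omega>)
      have "(\<Sum>n=1..t. indicator (?E n) \<omega>) = (\<Sum>n=1..t. if n \<le> ?N \<omega> then 1 else 0 :: real)"
        using elim by (intro sum.cong) (auto simp: indicator_def)
      also have "\<dots> = real (card ({1..t} \<inter> {n. n \<le> ?N \<omega>}))"
        by (simp add: sum.If_cases)
      also have "{1..t} \<inter> {n. n \<le> ?N \<omega>} = {1..?N \<omega>}"
        using elim(2) by auto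
      finally show ?case by simp
    qed
  qed measurable
  also have "\<dots> = (\<Sum>n=1..t. prob (?E n))"
    by (subst Bochner_Integration.integral_sum) (auto simp: emeasure_eq_measure)
  also have "\<dots> = (\<Sum>n=1..t. \<Sum>r=0..t. prob {\<omega> \<in> space M. epoch n \<omega> = r})"
    using prob_in_finite_set[OF measurable_epoch, of "{0..t}"] by simp
  finally show ?thesis .
qed

lemma state_polynomial_eq_bell:
  fixes v :: "'b::{real_normed_field, banach, second_countable_topology}"
  shows "state_polynomial M (generator_process \<Delta>) v t
           = (\<Sum>r=0..t. of_real (state_prob M (generator_process \<Delta>) 0 (t - r))
                 * complete_bell r (\<lambda>k. of_real (\<psi> k)) v)"
proof -
  let ?p = "\<lambda>n r. prob {\<omega> \<in> space M. epoch n \<omega> = r}"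
  let ?\<Phi> = "state_prob M (generator_process \<Delta>) 0"
  have "state_polynomial M (generator_process \<Delta>) v t
          = (\<Sum>n=0..t. \<Sum>r=0..t. v ^ n * of_real (?p n r * ?\<Phi> (t - r)))"
    by (simp only: state_polynomial_eq_sum state_prob_eq_convolution[of _ t] of_real_sum
          sum_distrib_left)
  also have "\<dots> = (\<Sum>r=0..t. \<Sum>n=0..t. v ^ n * of_real (?p n r * ?\<Phi> (t - r)))"
    by (rule sum.swap)
  also have "\<dots> = (\<Sum>r=0..t. of_real (?\<Phi> (t - r)) * (\<Sum>n=0..t. v ^ n * of_real (?p n r)))"
    by (simp add: sum_distrib_left mult_ac)
  also have "\<dots> = (\<Sum>r=0..t. of_real (?\<Phi> (t - r)) * complete_bell r (\<lambda>k. of_real (\<psi> k)) v)"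
    by (intro sum.cong) (auto simp: complete_bell_eq_generating_function)
  finally show ?thesis .
qed

lemma expectation_eq_bell:
  "(LINT \<omega>|M. real (generator_process \<Delta> t \<omega>)) = (\<Sum>r=1..t. complete_bell r \<psi> 1)"
proof -
  let ?p = "\<lambda>n r. prob {\<omega> \<in> space M. epoch n \<omega> = r}"
  have "(LINT \<omega>|M. real (generator_process \<Delta> t \<omega>)) = (\<Sum>n=1..t. \<Sum>r=0..t. ?p n r)"
    by (rule expectation_generator_process)
  also have "\<dots> = (\<Sum>n=1..t. \<Sum>r=1..t. ?p n r)"
    by (intro sum.cong refl sum.mono_neutral_right) (auto simp: prob_epoch_less not_le)
  also have "\<dots> = (\<Sum>r=1..t. \<Sum>n=1..t. ?p n r)"
    by (rule sum.swap)
  also have "\<dots> = (\<Sum>r=1..t. complete_bell r \<psi> 1)"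
  proof (intro sum.cong refl)
    fix r assume r: "r \<in> {1..t}"
    have "complete_bell r \<psi> 1 = (\<Sum>n=0..t. ?p n r)"
      using r complete_bell_eq_generating_function[of r t "1::real"] by simp
    also have "\<dots> = (\<Sum>n=1..t. ?p n r)"
      using r by (simp add: sum.atLeast_Suc_atMost[of 0] prob_epoch_0)
    finally show "(\<Sum>n=1..t. ?p n r) = complete_bell r \<psi> 1"
      by simp
  qed
  finally show ?thesis .
qed

end

theorem mainTheorem7:
  fixes M :: "'a measure"
    and \<psi> :: "nat \<Rightarrow> real"
    and \<Delta> :: "nat \<Rightarrow> 'a \<Rightarrow> nat"
    and N :: "nat \<Rightarrow> 'a \<Rightarrow> nat"
    and v :: "'b::{real_normed_field, banach, second_countable_topology}"
    and t :: nat
  assumes "iid_waiting_times M \<psi> \<Delta>"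
    and "N = generator_process \<Delta>"
  shows "state_polynomial M N v t = (\<Sum>n=0..t. v ^ n * of_real (state_prob M N n t))
      \<and> state_polynomial M N v t =
           (\<Sum>r=0..t. of_real (state_prob M N 0 (t - r)) * complete_bell r (\<lambda>k. of_real (\<psi> k)) v)
      \<and> (1 \<le> t \<longrightarrow> (LINT \<omega>|M. real (N t \<omega>)) = (\<Sum>r=1..t. complete_bell r \<psi> 1))
      \<and> (LINT \<omega>|M. real (N 0 \<omega>)) = 0"
proof -
  interpret iid_waiting_times M \<psi> \<Delta>
    by fact
  show ?thesis
    unfolding assms(2)
    by (intro conjI impI state_polynomial_eq_sum state_polynomial_eq_bell expectation_eq_bell)
       (simp add: expectation_eq_bell)
qed

end
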